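(* Let $K>1$, $0<t<2$ and $t'=\frac{2Kt}{2+(K-1)t}$. Let $\phi:\mathbb{C}\to\mathbb{C}$ be the $K$-quasiconformal mapping $\phi=\lim_{N\to\infty}\phi_N$ obtained from the iterative construction described in the context. Then $\phi$ is locally Hölder continuous with exponent $t/t'$, i.e. there is a constant $C$ such that $|\phi(z)-\phi(w)|\leq C|z-w|^{t/t'}$ whenever $z,w\in\mathbb{C}$, $|z-w|<1$.
   Context: Notation. $\mathbb{D}$ is the unit disk, $D(z,r)$ the disk of center $z$ and radius $r$, and $\alpha D(z,r)=D(z,\alpha r)$ for $\alpha>0$. A $K$-quasiconformal mapping is a homeomorphism $f\in W^{1,2}_{loc}$ satisfying $\overline\partial f=\mu\,\partial f$ a.e. for some measurable $\mu$ with $|\mu|\leq\frac{K-1}{K+1}$ a.e. Parameters. Fix $K>1$, $0<t<2$. For each step $k\in\mathbb{N}$, $k\ge 1$, choose finitely many pairwise disjoint disks $D(z^{i}_{k,j},R_{k,j})\subset\mathbb{D}$, $1\leq j\leq l_k$, $1\leq i\leq m_{k,j}$, covering a proportion $1-\varepsilon_k$ of the area of $\mathbb{D}$, i.e. $\sum_{j=1}^{l_k}m_{k,j}R_{k,j}^2=1-\varepsilon_k$, where $0<\varepsilon_k<1$ and $\varepsilon_k\to0$ so fast that $\prod_{k\ge1}(1-\varepsilon_k)$ converges to a positive number. The radii satisfy $R_{k,j}<\delta_k$ with $\delta_k>0$ as small as one wishes. Define $\sigma_{k,j}>0$ by $(\sigma_{k,j})^{tK}=(R_{k,j})^{2-t}$;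 the radii are small enough that $\sigma_{k,j}<\frac1{100}$ for all $k,j$. Put $\varphi^{i}_{k,j}(z)=z^{i}_{k,j}+(\sigma_{k,j})^K R_{k,j}\,z$ and $\psi^{i}_{k,j}(z)=z^{i}_{k,j}+\sigma_{k,j}R_{k,j}\,z$. Protecting and generating disks. For multiindexes $I=(i_1,\dots,i_N)$, $J=(j_1,\dots,j_N)$ with $1\leq j_k\leq l_k$, $1\leq i_k\leq m_{k,j_k}$, let $G^N_{I;J}=\varphi^{i_1}_{1,j_1}\circ\dots\circ\varphi^{i_N}_{N,j_N}(\mathbb{D})$ (generating disk of generation $N$) and $P^N_{I;J}=\frac{1}{(\sigma_{N,j_N})^K}G^N_{I;J}$ (protecting disk of generation $N$, concentric with $G^N_{I;J}$). Also $G^0=\mathbb{D}$. The mappings. Let $\phi_0$ be the identity and, inductively for $N\geq1$, $\phi_N=g_N\circ\phi_{N-1}$, where $g_N$ is defined as follows. For each $I,J$ of length $N$, $D^I_J=\phi_{N-1}(P^N_{I;J})$ is a disk $D(z^I_J,r_J)$ with $r_J=\sigma_{1,j_1}\cdots\sigma_{N-1,j_{N-1}}\,R_{1,j_1}\cdots R_{N,j_N}$, and $(D^I_J)'=\phi_{N-1}(G^N_{I;J})=D(z^I_J,(\sigma_{N,j_N})^K r_J)$. Set $$g_N(z)=\begin{cases}(\sigma_{N,j_N})^{1-K}(z-z^I_J)+z^I_J, & z\in (D^I_J)',\\ \left|\frac{z-z^I_J}{r_J}\right|^{\frac1K-1}(z-z^I_J)+z^I_J, & z\in D^I_J\setminus(D^I_J)',\\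 z, & z\notin\bigcup_{I,J} D^I_J.\end{cases}$$ Each $\phi_N$ is $K$-quasiconformal and equals the identity outside $\mathbb{D}$; the limit $\phi=\lim_{N\to\infty}\phi_N$ exists and is a $K$-quasiconformal mapping of $\mathbb{C}$. It maps the compact set $E=\bigcap_{N\ge1}\bigcup_{I,J}\varphi^{i_1}_{1,j_1}\circ\dots\circ\varphi^{i_N}_{N,j_N}(\overline{\mathbb{D}})$ onto $\phi(E)=\bigcap_{N\ge1}\bigcup_{I,J}\psi^{i_1}_{1,j_1}\circ\dots\circ\psi^{i_N}_{N,j_N}(\overline{\mathbb{D}})$. It is a known theorem of Uriarte-Tuero that with such a choice of parameters $0<\mathcal{H}^t(E)<\infty$ and $0<\mathcal{H}^{t'}(\phi(E))<\infty$, where $\mathcal{H}^s$ is $s$-dimensional Hausdorff measure. *)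

theory Defs
  imports "HOL-Analysis.Analysis"
begin

text \<open>
  Steps \<open>k\<close> and the indices \<open>j\<close>, \<open>i\<close> start at 1; values of the data outside
  \<open>1 \<le> k\<close>, \<open>1 \<le> j \<le> l k\<close>, \<open>1 \<le> i \<le> m k j\<close> are irrelevant.
  The disk of step \<open>k\<close> with indices \<open>j\<close>, \<open>i\<close> is \<open>ball (c k j i) (R k j)\<close>.
\<close>

locale qc_construction =
  fixes K t :: real
    and l :: "nat \<Rightarrow> nat"
    and m :: "nat \<Rightarrow> nat \<Rightarrow> nat"
    and c :: "nat \<Rightarrow> nat \<Rightarrow> nat \<Rightarrow> complex"
    and R :: "nat \<Rightarrow> nat \<Rightarrow> real"
    and \<sigma> :: "nat \<Rightarrow> nat \<Rightarrow> real"
    and \<epsilon> \<delta> :: "nat \<Rightarrow> real"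
  assumes K_gt_1: "1 < K"
    and t_pos: "0 < t" and t_less_2: "t < 2"
    and R_pos: "\<And>k j. \<lbrakk>1 \<le> k; j \<in> {1..l k}\<rbrakk> \<Longrightarrow> 0 < R k j"
    and disk_subset: "\<And>k j i. \<lbrakk>1 \<le> k; j \<in> {1..l k}; i \<in> {1..m k j}\<rbrakk>
           \<Longrightarrow> ball (c k j i) (R k j) \<subseteq> ball 0 1"
    and disks_disjoint: "\<And>k. 1 \<le> k
           \<Longrightarrow> disjoint_family_on (\<lambda>(j, i). ball (c k j i) (R k j)) (SIGMA j:{1..l k}. {1..m k j})"
    and area: "\<And>k. 1 \<le> k \<Longrightarrow> (\<Sum>j=1..l k. real (m k j) * (R k j)\<^sup>2) = 1 - \<epsilon> k"
    and \<epsilon>_pos: "\<And>k. 1 \<le> k \<Longrightarrow> 0 < \<epsilon> k"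
    and \<epsilon>_less_1: "\<And>k. 1 \<le> k \<Longrightarrow> \<epsilon> k < 1"
    and \<epsilon>_tendsto_0: "\<epsilon> \<longlonglongrightarrow> 0"
    and \<epsilon>_prod: "\<exists>p>0. (\<lambda>k. 1 - \<epsilon> (Suc k)) has_prod p"
    and \<delta>_pos: "\<And>k. 1 \<le> k \<Longrightarrow> 0 < \<delta> k"
    and R_less_\<delta>: "\<And>k j. \<lbrakk>1 \<le> k; j \<in> {1..l k}\<rbrakk> \<Longrightarrow> R k j < \<delta> k"
    and \<sigma>_pos: "\<And>k j. \<lbrakk>1 \<le> k; j \<in> {1..l k}\<rbrakk> \<Longrightarrow> 0 < \<sigma> k j"
    and \<sigma>_eq: "\<And>k j. \<lbrakk>1 \<le> k; j \<in> {1..l k}\<rbrakk>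
           \<Longrightarrow> \<sigma> k j powr (t * K) = R k j powr (2 - t)"
    and \<sigma>_small: "\<And>k j. \<lbrakk>1 \<le> k; j \<in> {1..l k}\<rbrakk> \<Longrightarrow> \<sigma> k j < 1 / 100"
begin

definition sim :: "nat \<Rightarrow> nat \<Rightarrow> nat \<Rightarrow> complex \<Rightarrow> complex" where
  "sim k j i z = c k j i + complex_of_real (\<sigma> k j powr K * R k j) * z"

text \<open>Pairs \<open>(I, J)\<close> of multiindices of length \<open>N\<close>, as functions on \<open>{1..N}\<close>.\<close>

definition multi_indices :: "nat \<Rightarrow> ((nat \<Rightarrow> nat) \<times> (nat \<Rightarrow> nat)) set" where
  "multi_indices N = {(I, J). J \<in> (\<Pi>\<^sub>E k\<in>{1..N}. {1..l k}) \<and> I \<in> (\<Pi>\<^sub>E k\<in>{1..N}. {1..m k (J k)})}"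

text \<open>\<open>sim_comp N (I, J)\<close> is the composition over \<open>k = 1, \<dots>, N\<close>, with \<open>k = 1\<close> outermost.\<close>

primrec sim_comp :: "nat \<Rightarrow> (nat \<Rightarrow> nat) \<times> (nat \<Rightarrow> nat) \<Rightarrow> complex \<Rightarrow> complex" where
  "sim_comp 0 IJ = id"
| "sim_comp (Suc N) IJ = sim_comp N IJ \<circ> sim (Suc N) (snd IJ (Suc N)) (fst IJ (Suc N))"

definition gen_disk :: "nat \<Rightarrow> (nat \<Rightarrow> nat) \<times> (nat \<Rightarrow> nat) \<Rightarrow> complex set" where
  "gen_disk N IJ = sim_comp N IJ ` ball 0 1"

text \<open>The protecting disk is the generating disk dilated by \<open>1 / \<sigma>\<^sup>K\<close> about its centre,
  which is the point \<open>sim_comp N (I, J) 0\<close>.\<close>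

definition prot_disk :: "nat \<Rightarrow> (nat \<Rightarrow> nat) \<times> (nat \<Rightarrow> nat) \<Rightarrow> complex set" where
  "prot_disk N IJ =
     (\<lambda>w. sim_comp N IJ 0 + (1 / \<sigma> N (snd IJ N) powr K) *\<^sub>R (w - sim_comp N IJ 0)) ` gen_disk N IJ"

definition img_radius :: "nat \<Rightarrow> (nat \<Rightarrow> nat) \<times> (nat \<Rightarrow> nat) \<Rightarrow> real" where
  "img_radius N IJ = (\<Prod>k\<in>{1..<N}. \<sigma> k (snd IJ k)) * (\<Prod>k\<in>{1..N}. R k (snd IJ k))"

text \<open>In the next two definitions \<open>f\<close> stands for \<open>\<phi>\<^bsub>N-1\<^esub>\<close>. The image of a protecting disk
  under \<open>f\<close> is a disk, and \<open>img_centre\<close> is its centre. The images of the protecting disks of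
  generation \<open>N\<close> are pairwise disjoint, so that \<open>IJ\<close> below is unique.\<close>

definition img_centre :: "nat \<Rightarrow> (complex \<Rightarrow> complex) \<Rightarrow> (nat \<Rightarrow> nat) \<times> (nat \<Rightarrow> nat) \<Rightarrow> complex" where
  "img_centre N f IJ = (THE x. f ` prot_disk N IJ = ball x (img_radius N IJ))"

definition g :: "nat \<Rightarrow> (complex \<Rightarrow> complex) \<Rightarrow> complex \<Rightarrow> complex" where
  "g N f z =
     (if \<exists>IJ\<in>multi_indices N. z \<in> f ` prot_disk N IJ then
        let IJ = (THE IJ. IJ \<in> multi_indices N \<and> z \<in> f ` prot_disk N IJ);
            x = img_centre N f IJ
        in if z \<in> f ` gen_disk N IJ
           then (\<sigma> N (snd IJ N) powr (1 - K)) *\<^sub>R (z - x) + x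
           else (cmod ((z - x) / complex_of_real (img_radius N IJ)) powr (1 / K - 1)) *\<^sub>R (z - x) + x
      else z)"

primrec phi :: "nat \<Rightarrow> complex \<Rightarrow> complex" where
  "phi 0 = id"
| "phi (Suc N) = g (Suc N) (phi N) \<circ> phi N"

definition phi_lim :: "complex \<Rightarrow> complex" where
  "phi_lim z = lim (\<lambda>N. phi N z)"

end

end

theory Submission imports Defs begin

text \<open>
  The exponent \<open>\<beta> = t / t'\<close> is the one for which one step of the construction is
  scale invariant: the relation \<open>\<sigma> powr (t * K) = R powr (2 - t)\<close> says exactly that
  \<open>(\<sigma>\<^sup>K R)\<^sup>\<beta> = \<sigma> R\<close> (lemma \<open>scale_powr\<close>), so that a generating disk of
  relative radius \<open>\<sigma>\<^sup>K R\<close> is sent to a disk of relative radius \<open>(\<sigma>\<^sup>K R)\<^sup>\<beta>\<close>.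

  The construction is therefore read from the outside inwards. Let \<open>tail_map d n\<close> be the map
  built by the same recipe from the steps \<open>n + 1, \<dots>, n + d\<close> only. It is the identity outside
  the disks of step \<open>n + 1\<close>; in such a disk it is a rescaled radial stretching on the outer
  annulus, and on the inner disk a rescaled copy of \<open>tail_map (d - 1) (n + 1)\<close>. Two points in
  the same inner disk inherit the Hoelder estimate of the rescaled copy with the same
  constant, by scale invariance. All other pairs are handled without induction:
  on an annulus the radial stretching satisfies the estimate with constant 4
  (\<open>annulus_holder\<close>), and two points that are not in a common disk are compared with the
  points at which the segment between them leaves the disks, where the map is the identity
  (\<open>level_map_holder_separated\<close>). The latter case includes a point of the unit disk and one of the
  unit circle; rescaled, this lets a point of an inner disk be compared with a point of the annulus
  around it, by way of a point of the circle between them. The resulting constant 14 does not grow with the number of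
  steps (\<open>level_map_distorts_well\<close>).

  It remains to identify \<open>\<phi>\<^sub>N\<close>, which is defined by composing on the outside with \<open>g\<^sub>N\<close>, with
  \<open>tail_map N 0\<close>. This rests on the fact that \<open>\<phi>\<^sub>n\<close> carries the \<open>n\<close>-fold similarity
  \<open>sim_comp n IJ\<close> to its analogue \<open>psi_comp n IJ\<close>, and that no point outside a generating disk
  is sent into its image (\<open>conjugates_all\<close>). Each additional step changes \<open>tail_map d n\<close> by at
  most a geometrically small amount, so the limit exists, and it inherits the estimate.
\<close>

section \<open>Radial stretchings\<close>

definition radial_stretch :: "real \<Rightarrow> complex \<Rightarrow> complex" where
  "radial_stretch K z = (cmod z powr (1 / K - 1)) *\<^sub>R z"

lemma norm_radial_stretch: "cmod (radial_stretch K z) = cmod z powr (1 / K)"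
proof (cases "z = 0")
  case False
  then have "cmod z powr (1 / K - 1) * cmod z powr 1 = cmod z powr (1 / K)"
    by (subst powr_add [symmetric]) simp
  with False show ?thesis by (simp add: radial_stretch_def)
qed (simp add: radial_stretch_def)

text \<open>
  The exponent \<open>1 / K - 1\<close> is at most 0, so the stretching is worst near the origin, yet the point
  farther from the origin determines the constant: multiplying \<open>y\<close> by the factor that belongs to
  \<open>x\<close> instead of its own moves it radially, by at most
  \<open>cmod x powr (1 / K - 1) * (cmod x - cmod y)\<close> because \<open>r powr (1 / K)\<close> increases with \<open>r\<close>.
\<close>

lemma radial_stretch_dist_le:
  assumes K: "1 \<le> K" and le: "cmod y \<le> cmod x"
  shows "cmod (radial_stretch K x - radial_stretch K y)
    \<le> 2 * cmod x powr (1 / K - 1) * cmod (x - y)"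
proof -
  define p where "p = 1 / K - 1"
  have p: "p \<le> 0" "0 \<le> 1 / K" using K by (auto simp: p_def)
  have np: "cmod u powr p * cmod u = cmod u powr (1 / K)" for u
    using norm_radial_stretch [of K u] by (simp add: radial_stretch_def p_def)
  have anti: "cmod x powr p \<le> cmod y powr p" if "y \<noteq> 0"
    using that le p by (intro powr_mono2') auto
  have "radial_stretch K x - radial_stretch K y
      = (cmod x powr p) *\<^sub>R (x - y) - (cmod y powr p - cmod x powr p) *\<^sub>R y"
    by (simp add: radial_stretch_def p_def algebra_simps)
  then have "cmod (radial_stretch K x - radial_stretch K y)
      \<le> cmod ((cmod x powr p) *\<^sub>R (x - y)) + cmod ((cmod y powr p - cmod x powr p) *\<^sub>R y)"
    by (metis norm_triangle_ineq4)
  also have "\<dots> = cmod x powr p * cmod (x - y) + (cmod y powr p - cmod x powr p) * cmod y"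
    using anti by (cases "y = 0") auto
  also have "(cmod y powr p - cmod x powr p) * cmod y
      \<le> cmod x powr p * (cmod x - cmod y)"
    using powr_mono2 [OF p(2) norm_ge_zero le] by (simp add: left_diff_distrib right_diff_distrib np)
  also have "\<dots> \<le> cmod x powr p * cmod (x - y)"
    by (intro mult_left_mono norm_triangle_ineq2) auto
  finally show ?thesis by (simp add: p_def algebra_simps)
qed

text \<open>
  Interpolation between the Lipschitz bound at the larger modulus \<open>r\<close> and the trivial bound
  \<open>cmod (x - y) \<le> 2 * r\<close>. The power of \<open>r\<close> that remains is nonpositive, so it is largest on
  the inner circle of radius \<open>s\<close>.
\<close>

lemma radial_stretch_holder:
  assumes K: "1 \<le> K" and \<beta>: "1 / K \<le> \<beta>" "\<beta> \<le> 1"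
    and s: "0 < s" "s \<le> cmod x" "s \<le> cmod y"
  shows "cmod (radial_stretch K x - radial_stretch K y)
    \<le> 4 * s powr (1 / K - \<beta>) * cmod (x - y) powr \<beta>"
proof -
  have *: "cmod (radial_stretch K x - radial_stretch K y)
      \<le> 4 * s powr (1 / K - \<beta>) * cmod (x - y) powr \<beta>"
    if le: "cmod y \<le> cmod x" and sx: "s \<le> cmod x" for x y
  proof (cases "x = y")
    case False
    define r where "r = cmod x"
    have r: "0 < r" using s(1) sx unfolding r_def by linarith
    have d: "cmod (x - y) \<le> 2 * r"
      using norm_triangle_ineq4 [of x y] le by (simp add: r_def)
    have "cmod (x - y) = cmod (x - y) powr \<beta> * cmod (x - y) powr (1 - \<beta>)"
      using False by (simp flip: powr_add)
    also have "\<dots> \<le> cmod (x - y) powr \<beta> * (2 * r) powr (1 - \<beta>)"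
      using d \<beta> by (intro mult_left_mono powr_mono2) auto
    also have "(2 * r) powr (1 - \<beta>) \<le> 2 * r powr (1 - \<beta>)"
    proof -
      have "(2::real) powr (1 - \<beta>) \<le> 2 powr 1"
        using \<beta> K by (intro powr_mono) (auto intro: order_trans [of 0 "1/K"])
      then show ?thesis using r by (simp add: powr_mult mult_right_mono)
    qed
    finally have "2 * r powr (1 / K - 1) * cmod (x - y)
        \<le> 2 * r powr (1 / K - 1) * (cmod (x - y) powr \<beta> * (2 * r powr (1 - \<beta>)))"
      by (intro mult_left_mono) (auto simp: mult_left_mono)
    also have "\<dots> = 4 * (r powr (1 / K - 1) * r powr (1 - \<beta>)) * cmod (x - y) powr \<beta>"
      by simp
    also have "r powr (1 / K - 1) * r powr (1 - \<beta>) = r powr (1 / K - \<beta>)"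
      by (simp flip: powr_add)
    finally have "cmod (radial_stretch K x - radial_stretch K y)
        \<le> 4 * r powr (1 / K - \<beta>) * cmod (x - y) powr \<beta>"
      using radial_stretch_dist_le [OF K le] unfolding r_def by linarith
    also have "r powr (1 / K - \<beta>) \<le> s powr (1 / K - \<beta>)"
      using \<beta> s(1) sx by (intro powr_mono2') (auto simp: r_def)
    finally show ?thesis by (simp add: mult_right_mono)
  qed simp
  show ?thesis
    using * [of y x] * [of x y] s by (cases "cmod y \<le> cmod x") (auto simp: norm_minus_commute)
qed

section \<open>Elementary estimates\<close>

lemma segment_meets_sphere:
  fixes z w c :: complex
  assumes z: "z \<in> ball c r" and w: "w \<notin> ball c r"
  obtains v where "v \<in> closed_segment z w" "cmod (v - c) = r"
proof -
  have r: "0 < r" using z by (auto intro: le_less_trans [OF zero_le_dist])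
  have "closed_segment z w \<inter> frontier (ball c r) \<noteq> {}"
    using z w by (intro connected_Int_frontier connected_segment) blast+
  then obtain v where v: "v \<in> closed_segment z w" "v \<in> frontier (ball c r)"
    by blast
  have "cmod (v - c) = r" using v(2) r by (simp add: dist_norm norm_minus_commute)
  with v(1) show ?thesis by (rule that)
qed

lemma le_two_powr:
  fixes x \<beta> :: real
  assumes "0 \<le> x" "x \<le> 2" "0 \<le> \<beta>" "\<beta> \<le> 1"
  shows "x \<le> 2 * x powr \<beta>"
proof (cases "x = 0")
  case False
  have "x = x powr \<beta> * x powr (1 - \<beta>)"
    using assms False by (simp flip: powr_add)
  also have "x powr (1 - \<beta>) \<le> 2 powr (1 - \<beta>)"
    using assms by (intro powr_mono2) auto
  also have "(2::real) powr (1 - \<beta>) \<le> 2 powr 1"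
    using assms by (intro powr_mono) auto
  finally show ?thesis by (simp add: mult_left_mono mult.commute [of 2])
qed simp

section \<open>One step of the construction\<close>

context qc_construction
begin

definition holder_exponent :: real where
  "holder_exponent = (2 + (K - 1) * t) / (2 * K)"

abbreviation \<beta> :: real where "\<beta> \<equiv> holder_exponent"

lemma holder_exponent_bounds: "1 / K \<le> \<beta>" "\<beta> \<le> 1" "0 \<le> \<beta>"
proof -
  have "(K - 1) * t \<le> (K - 1) * 2"
    using K_gt_1 t_less_2 by (intro mult_left_mono) auto
  then show "\<beta> \<le> 1" using K_gt_1 by (simp add: holder_exponent_def)
  show 1: "1 / K \<le> \<beta>"
    using K_gt_1 t_pos by (simp add: holder_exponent_def field_simps)
  have "0 \<le> 1 / K" using K_gt_1 by simp
  with 1 show "0 \<le> \<beta>" by linarith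
qed

text \<open>
  Scale invariance of one step. After taking logarithms, the relation between \<open>\<sigma>\<close> and \<open>R\<close> turns
  it into a linear identity.
\<close>

lemma scale_powr:
  assumes "1 \<le> k" "j \<in> {1..l k}"
  shows "(\<sigma> k j powr K * R k j) powr \<beta> = \<sigma> k j * R k j"
proof -
  note s = \<sigma>_pos [OF assms] and r = R_pos [OF assms]
  define a b where "a = ln (\<sigma> k j)" and "b = ln (R k j)"
  have sa: "\<sigma> k j = exp a" and rb: "R k j = exp b"
    using s r by (auto simp: a_def b_def)
  have e: "t * K * a = (2 - t) * b"
    using \<sigma>_eq [OF assms] by (simp add: sa rb powr_def)
  have "2 * K * (a + b) = (2 + (K - 1) * t) * (K * a + b)"
    using e by algebra
  then have "\<beta> * (K * a + b) = a + b"
    using K_gt_1 by (simp add: holder_exponent_def field_simps)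
  then show ?thesis
    by (simp add: sa rb powr_def ln_mult flip: exp_add)
qed

lemma R_less_1:
  assumes "1 \<le> k" "j \<in> {1..l k}" shows "R k j < 1"
proof (rule ccontr)
  assume "\<not> R k j < 1"
  then have "1 \<le> R k j powr (2 - t)" using t_less_2 by (intro ge_one_powr_ge_zero) auto
  moreover have "\<sigma> k j powr (t * K) < 1 powr (t * K)"
    using \<sigma>_pos [OF assms] \<sigma>_small [OF assms] t_pos K_gt_1 by (intro powr_less_mono2) auto
  ultimately show False using \<sigma>_eq [OF assms] by simp
qed

definition index :: "nat \<Rightarrow> (nat \<times> nat) set" where
  "index k = (SIGMA j:{1..l k}. {1..m k j})"

definition disk :: "nat \<Rightarrow> nat \<times> nat \<Rightarrow> complex set" where
  "disk k p = ball (c k (fst p) (snd p)) (R k (fst p))"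

lemma disk_unique:
  assumes "1 \<le> k" "p \<in> index k" "q \<in> index k" "x \<in> disk k p" "x \<in> disk k q"
  shows "p = q"
  using disks_disjoint [OF assms(1)] assms(2-)
  unfolding disjoint_family_on_def index_def disk_def split_beta by blast

text \<open>
  One step of the construction with the map \<open>h\<close>, rescaled, inserted in each inner disk. With
  \<open>h = id\<close> this is the effect of step \<open>k\<close> alone.
\<close>

definition level_map :: "nat \<Rightarrow> (complex \<Rightarrow> complex) \<Rightarrow> complex \<Rightarrow> complex" where
  "level_map k h x =
     (if \<exists>p\<in>index k. x \<in> disk k p then
        let (j, i) = (THE p. p \<in> index k \<and> x \<in> disk k p);
            y = (x - c k j i) / of_real (R k j)
        in if cmod y < \<sigma> k j powr K
           then c k j i + of_real (\<sigma> k j * R k j) * h (y / of_real (\<sigma> k j powr K))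
           else c k j i + of_real (R k j) * radial_stretch K y
      else x)"

lemma level_map_outside: "(\<And>p. p \<in> index k \<Longrightarrow> x \<notin> disk k p) \<Longrightarrow> level_map k h x = x"
  by (auto simp: level_map_def)

context
  fixes k j i
  assumes k: "1 \<le> k" and ji: "(j, i) \<in> index k"
begin

lemma data_pos: "0 < R k j" "R k j < 1" "0 < \<sigma> k j" "\<sigma> k j < 1/100"
  using k ji R_pos R_less_1 \<sigma>_pos \<sigma>_small by (auto simp: index_def)

lemma core_scale: "0 < \<sigma> k j powr K" "\<sigma> k j powr K < 1/2"
proof -
  show "0 < \<sigma> k j powr K" using data_pos by simp
  have "\<sigma> k j powr K \<le> \<sigma> k j powr 1"
    using data_pos K_gt_1 by (intro powr_mono') auto
  then show "\<sigma> k j powr K < 1/2" using data_pos by simp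
qed

lemma disk_subset_unit: "disk k (j, i) \<subseteq> ball 0 1"
  using disk_subset [OF k] ji by (auto simp: disk_def index_def)

text \<open>
  In the coordinate \<open>y\<close> in which the disk is the unit disk, the map depends on \<open>k\<close> and \<open>j\<close> only
  through \<open>\<sigma> k j\<close>.
\<close>

lemma level_map_disk:
  assumes y: "cmod y < 1"
  shows "level_map k h (c k j i + of_real (R k j) * y) =
     c k j i + of_real (R k j) * (if cmod y < \<sigma> k j powr K
        then of_real (\<sigma> k j) * h (y / of_real (\<sigma> k j powr K)) else radial_stretch K y)"
proof -
  let ?x = "c k j i + of_real (R k j) * y"
  have x: "?x \<in> disk k (j, i)"
    using y data_pos by (simp add: disk_def dist_norm norm_mult)
  have "(THE p. p \<in> index k \<and> ?x \<in> disk k p) = (j, i)"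
    using x ji disk_unique [OF k] by blast
  then show ?thesis
    using x ji data_pos by (auto simp: level_map_def Let_def)
qed

lemma disk_cases:
  assumes "x \<in> disk k (j, i)"
  obtains y where "x = c k j i + of_real (R k j) * y" "cmod y < 1"
proof
  show "x = c k j i + of_real (R k j) * ((x - c k j i) / of_real (R k j))"
    using data_pos by simp
  show "cmod ((x - c k j i) / of_real (R k j)) < 1"
    using assms data_pos by (simp add: disk_def dist_norm norm_divide norm_minus_commute)
qed

lemma level_map_in_disk:
  assumes h: "\<And>x. cmod x < 1 \<Longrightarrow> cmod (h x) < 1" and x: "x \<in> disk k (j, i)"
  shows "level_map k h x \<in> disk k (j, i)"
proof -
  obtain y where y: "x = c k j i + of_real (R k j) * y" "cmod y < 1"
    using x by (rule disk_cases)
  define y' where "y' = (if cmod y < \<sigma> k j powr K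
        then of_real (\<sigma> k j) * h (y / of_real (\<sigma> k j powr K)) else radial_stretch K y)"
  have "cmod y' < 1"
  proof (cases "cmod y < \<sigma> k j powr K")
    case True
    then have "cmod (h (y / of_real (\<sigma> k j powr K))) < 1"
      using core_scale by (intro h) (simp add: norm_divide)
    then have "\<sigma> k j * cmod (h (y / of_real (\<sigma> k j powr K))) < 1 * 1"
      using data_pos by (intro mult_strict_mono) auto
    then show ?thesis using True data_pos by (simp add: y'_def norm_mult)
  next
    case False
    then show ?thesis
      using y(2) K_gt_1 powr_less_mono2 [of "1/K" "cmod y" 1]
      by (simp add: y'_def norm_radial_stretch)
  qed
  then have "c k j i + of_real (R k j) * y' \<in> disk k (j, i)"
    using data_pos by (simp add: disk_def dist_norm norm_mult)
  then show ?thesis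
    using level_map_disk [OF y(2), of h] by (simp add: y(1) y'_def)
qed

text \<open>
  The loss in the estimate for the stretching, taken at the inner radius \<open>\<sigma> powr K\<close>, is
  exactly compensated by the factor \<open>R powr (1 - \<beta>)\<close> that comes from rescaling. This follows
  from scale invariance since the stretching sends the inner circle to radius \<open>\<sigma>\<close>.
\<close>

lemma annulus_holder:
  assumes "\<sigma> k j powr K \<le> cmod x" "\<sigma> k j powr K \<le> cmod y"
  shows "cmod ((c k j i + of_real (R k j) * radial_stretch K x)
      - (c k j i + of_real (R k j) * radial_stretch K y))
    \<le> 4 * cmod ((c k j i + of_real (R k j) * x) - (c k j i + of_real (R k j) * y)) powr \<beta>"
proof -
  note pos = data_pos
  have "(\<sigma> k j powr K) powr \<beta> * R k j powr \<beta> = \<sigma> k j * R k j"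
    using scale_powr [of k j] k ji pos by (simp add: index_def powr_mult)
  then have e: "R k j * (\<sigma> k j powr K) powr (1 / K - \<beta>) = R k j powr \<beta>"
  proof -
    have "R k j * (\<sigma> k j powr K) powr (1 / K - \<beta>) = R k j * (\<sigma> k j / (\<sigma> k j powr K) powr \<beta>)"
      using pos K_gt_1 by (simp only: powr_diff powr_powr [of _ K "1 / K"]) simp
    also have "\<dots> = R k j powr \<beta>"
      using pos \<open>(\<sigma> k j powr K) powr \<beta> * R k j powr \<beta> = \<sigma> k j * R k j\<close>
      by (simp add: field_simps)
    finally show ?thesis .
  qed
  have "cmod ((c k j i + of_real (R k j) * radial_stretch K x)
      - (c k j i + of_real (R k j) * radial_stretch K y))
      = R k j * cmod (radial_stretch K x - radial_stretch K y)"
    using pos by (simp flip: right_diff_distrib add: norm_mult)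
  also have "\<dots> \<le> R k j * (4 * (\<sigma> k j powr K) powr (1 / K - \<beta>) * cmod (x - y) powr \<beta>)"
    using pos K_gt_1 core_scale assms holder_exponent_bounds
    by (intro mult_left_mono radial_stretch_holder) auto
  also have "\<dots> = 4 * (R k j powr \<beta> * cmod (x - y) powr \<beta>)"
    by (simp flip: e)
  also have "R k j powr \<beta> * cmod (x - y) powr \<beta>
      = cmod ((c k j i + of_real (R k j) * x) - (c k j i + of_real (R k j) * y)) powr \<beta>"
    using pos by (simp flip: right_diff_distrib add: norm_mult powr_mult)
  finally show ?thesis .
qed

text \<open>
  The level map extends by the identity to the boundary of the disk. From the annulus the bound is
  that of the stretching, which fixes the unit circle. A point of the inner disk is at distance
  comparable to \<open>R k j\<close> from the boundary; there it is enough that the disk is mapped to itself and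
  that \<open>R k j \<le> R k j powr \<beta>\<close>.
\<close>

lemma disk_boundary_holder:
  assumes h: "\<And>x. cmod x < 1 \<Longrightarrow> cmod (h x) < 1"
    and x: "x \<in> disk k (j, i)" and v: "cmod (v - c k j i) = R k j"
  shows "cmod (level_map k h x - v) \<le> 4 * cmod (x - v) powr \<beta>"
proof -
  note pos = data_pos and \<beta> = holder_exponent_bounds
  obtain y where y: "x = c k j i + of_real (R k j) * y" "cmod y < 1"
    using x by (rule disk_cases)
  define u where "u = (v - c k j i) / of_real (R k j)"
  have u: "v = c k j i + of_real (R k j) * u" "cmod u = 1"
    using pos v by (auto simp: u_def norm_divide)
  show ?thesis
  proof (cases "cmod y < \<sigma> k j powr K")
    case False
    have "radial_stretch K u = u" using u by (simp add: radial_stretch_def)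
    then show ?thesis
      using annulus_holder [of y u] False core_scale u level_map_disk [OF y(2), of h] y(1)
      by simp
  next
    case True
    have "1 / 2 \<le> cmod (y - u)"
      using True core_scale u norm_triangle_ineq2 [of u y] by (simp add: norm_minus_commute)
    then have R_le: "R k j \<le> 2 * cmod (x - v)"
      using pos by (simp add: y(1) u(1) norm_mult flip: right_diff_distrib)
    have "level_map k h x \<in> disk k (j, i)"
      using h x by (rule level_map_in_disk)
    then have "cmod (level_map k h x - v) \<le> 2 * R k j"
      using norm_triangle_ineq4 [of "level_map k h x - c k j i" "v - c k j i"] v
      by (simp add: disk_def dist_norm norm_minus_commute)
    also have "R k j \<le> 2 * cmod (x - v) powr \<beta>"
    proof -
      have "R k j \<le> R k j powr \<beta>"
        using powr_mono' [of \<beta> 1 "R k j"] \<beta> pos by simp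
      also have "\<dots> \<le> (2 * cmod (x - v)) powr \<beta>"
        using R_le pos \<beta> by (intro powr_mono2) auto
      also have "\<dots> \<le> 2 * cmod (x - v) powr \<beta>"
        using powr_mono [of \<beta> 1 "2::real"] \<beta> by (simp add: powr_mult mult_right_mono)
      finally show ?thesis .
    qed
    finally show ?thesis by simp
  qed
qed

end

text \<open>
  The properties that pass from \<open>h\<close> to \<open>level_map k h\<close>. The estimate towards the unit circle has
  the better constant 10: it is needed, together with the constant 4 on the annulus, to obtain 14
  again for a point of an inner disk and a point of the surrounding annulus.
\<close>

definition distorts_well :: "(complex \<Rightarrow> complex) \<Rightarrow> bool" where
  "distorts_well h \<longleftrightarrow>
     (\<forall>x. cmod x < 1 \<longrightarrow> cmod (h x) < 1) \<and>
     (\<forall>x u. cmod x < 1 \<longrightarrow> cmod u = 1 \<longrightarrow> cmod (h x - u) \<le> 10 * cmod (x - u) powr \<beta>) \<and>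
     (\<forall>x y. cmod (x - y) \<le> 2 \<longrightarrow> cmod (h x - h y) \<le> 14 * cmod (x - y) powr \<beta>)"

text \<open>
  Each of the two points is compared with the point at which the segment from it to the other
  one leaves its disk; the two exit points lie on the segment. The constant is
  \<open>4 + 2 + 4\<close>.
\<close>

lemma level_map_holder_separated:
  assumes k: "1 \<le> k" and h: "\<And>x. cmod x < 1 \<Longrightarrow> cmod (h x) < 1"
    and xy: "cmod (x - y) \<le> 2"
    and sep: "\<And>p. p \<in> index k \<Longrightarrow> x \<in> disk k p \<Longrightarrow> y \<notin> disk k p"
  shows "cmod (level_map k h x - level_map k h y) \<le> 10 * cmod (x - y) powr \<beta>"
proof -
  have exit: "\<exists>v \<in> closed_segment x y. cmod (level_map k h x - v) \<le> 4 * cmod (x - y) powr \<beta>"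
    if sep: "\<And>p. p \<in> index k \<Longrightarrow> x \<in> disk k p \<Longrightarrow> y \<notin> disk k p" for x y
  proof (cases "\<exists>p\<in>index k. x \<in> disk k p")
    case False
    then have "level_map k h x = x" by (intro level_map_outside) auto
    then show ?thesis by (intro bexI [of _ x]) auto
  next
    case True
    then obtain j i where ji: "(j, i) \<in> index k" "x \<in> disk k (j, i)" by auto
    then have "y \<notin> disk k (j, i)" using sep by blast
    then obtain v where v: "v \<in> closed_segment x y" "cmod (v - c k j i) = R k j"
      using ji segment_meets_sphere [of x "c k j i" "R k j" y] by (auto simp: disk_def)
    have "cmod (level_map k h x - v) \<le> 4 * cmod (x - v) powr \<beta>"
      using k h ji v by (intro disk_boundary_holder)
    also have "\<dots> \<le> 4 * cmod (x - y) powr \<beta>"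
      using dist_in_closed_segment(1) [OF v(1)] holder_exponent_bounds
      by (intro mult_left_mono powr_mono2) (auto simp: dist_norm norm_minus_commute)
    finally show ?thesis using v by blast
  qed
  obtain v where v: "v \<in> closed_segment x y"
      "cmod (level_map k h x - v) \<le> 4 * cmod (x - y) powr \<beta>"
    using exit [of x y] sep by blast
  obtain w where w: "w \<in> closed_segment x y"
      "cmod (level_map k h y - w) \<le> 4 * cmod (x - y) powr \<beta>"
    using exit [of y x] sep by (metis closed_segment_commute norm_minus_commute)
  have "cmod (v - w) \<le> cmod (x - y)"
    using segment_furthest_le [OF w(1), of v] dist_in_closed_segment [OF v(1)]
    by (auto simp: dist_norm norm_minus_commute)
  also have "\<dots> \<le> 2 * cmod (x - y) powr \<beta>"
    using xy holder_exponent_bounds by (intro le_two_powr) auto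
  finally have vw: "cmod (v - w) \<le> 2 * cmod (x - y) powr \<beta>" .
  have "level_map k h x - level_map k h y
      = (level_map k h x - v) + (v - w) - (level_map k h y - w)" by simp
  then have "cmod (level_map k h x - level_map k h y)
      \<le> cmod (level_map k h x - v) + cmod (v - w) + cmod (level_map k h y - w)"
    by (metis norm_triangle_le_diff norm_triangle_ineq add_right_mono)
  then show ?thesis using v(2) w(2) vw by linarith
qed

lemma distorts_well_id: "distorts_well id"
proof -
  have "cmod (x - y) \<le> 2 * cmod (x - y) powr \<beta>" if "cmod (x - y) \<le> 2" for x y
    using that holder_exponent_bounds by (intro le_two_powr) auto
  moreover have "cmod (x - u) \<le> 2" if "cmod x < 1" "cmod u = 1" for x u
    using norm_triangle_ineq4 [of x u] that by linarith
  moreover have "0 \<le> cmod (x - y) powr \<beta>" for x y by simp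
  ultimately show ?thesis
    unfolding distorts_well_def id_apply by (smt (verit))
qed

text \<open>
  By \<open>scale_powr\<close> the factors from the two rescalings cancel, so the constant is unchanged.
\<close>

lemma core_rescale:
  assumes k: "1 \<le> k" and ji: "(j, i) \<in> index k"
    and le: "cmod a \<le> C * cmod (x / of_real (\<sigma> k j powr K)) powr \<beta>"
  shows "cmod (of_real (R k j) * (of_real (\<sigma> k j) * a)) \<le> C * cmod (of_real (R k j) * x) powr \<beta>"
proof -
  note pos = data_pos [OF k ji] core_scale [OF k ji]
  have e: "(\<sigma> k j powr K * R k j) powr \<beta> = \<sigma> k j * R k j"
    using scale_powr k ji by (auto simp: index_def)
  have "cmod (of_real (R k j) * (of_real (\<sigma> k j) * a)) = \<sigma> k j * R k j * cmod a"
    using pos by (simp add: norm_mult)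
  also have "\<dots> \<le> \<sigma> k j * R k j * (C * cmod (x / of_real (\<sigma> k j powr K)) powr \<beta>)"
    using pos le by (intro mult_left_mono) auto
  also have "\<dots> = C * ((\<sigma> k j powr K * R k j) powr \<beta> * cmod (x / of_real (\<sigma> k j powr K)) powr \<beta>)"
    by (simp add: e)
  also have "\<dots> = C * (\<sigma> k j powr K * R k j * cmod (x / of_real (\<sigma> k j powr K))) powr \<beta>"
    using pos by (simp add: powr_mult)
  also have "\<sigma> k j powr K * R k j * cmod (x / of_real (\<sigma> k j powr K)) = cmod (of_real (R k j) * x)"
    using pos by (simp add: norm_mult norm_divide)
  finally show ?thesis .
qed

lemma same_disk_holder:
  assumes k: "1 \<le> k" and ji: "(j, i) \<in> index k" and h: "distorts_well h"
    and x: "cmod x < 1" and y: "cmod y < 1"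
  defines "T \<equiv> \<lambda>x. c k j i + of_real (R k j) * x"
  shows "cmod (level_map k h (T x) - level_map k h (T y)) \<le> 14 * cmod (T x - T y) powr \<beta>"
proof -
  note pos = data_pos [OF k ji] core_scale [OF k ji]
  define s where "s = \<sigma> k j powr K"
  have s: "0 < s" using pos by (simp add: s_def)
  define q where "q = (\<lambda>x. of_real (\<sigma> k j) * h (x / of_real s))"
  note L = level_map_disk [OF k ji, folded T_def, folded s_def, of _ h]
  have L_core: "level_map k h (T x) = T (q x)" if "cmod x < s" for x
    using L [of x] that pos by (simp add: T_def q_def s_def)
  have L_ann: "level_map k h (T x) = T (radial_stretch K x)" if "s \<le> cmod x" "cmod x < 1" for x
    using L [of x] that by (simp add: T_def)
  have Tdiff: "T x - T y = of_real (R k j) * (x - y)" for x y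
    by (simp add: T_def algebra_simps)
  have T_ann: "cmod (T (radial_stretch K x) - T (radial_stretch K y)) \<le> 4 * cmod (T x - T y) powr \<beta>"
    if "s \<le> cmod x" "s \<le> cmod y" for x y
    using annulus_holder [OF k ji, of x y] that by (simp add: T_def s_def)
  have mixed: "cmod (T (q x) - T (radial_stretch K y)) \<le> 14 * cmod (T x - T y) powr \<beta>"
    if xs: "cmod x < s" and ys: "s \<le> cmod y" for x y
  proof -
    \<comment> \<open>Where the segment crosses the inner circle, both formulas for the map agree.\<close>
    obtain u where u: "u \<in> closed_segment x y" "cmod u = s"
      using segment_meets_sphere [of x 0 s y] xs ys by auto
    define u' where "u' = u / of_real s"
    have u': "cmod u' = 1" using u s by (simp add: u'_def norm_divide)
    have "s powr (1 / K) = \<sigma> k j"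
      using pos K_gt_1 by (simp add: s_def powr_powr)
    then have ru: "radial_stretch K u = of_real (\<sigma> k j) * u'"
      using s by (simp add: radial_stretch_def u u'_def powr_diff scaleR_conv_of_real)
    have "cmod (h (x / of_real s) - u') \<le> 10 * cmod (x / of_real s - u') powr \<beta>"
      using h xs s u' by (simp add: distorts_well_def norm_divide)
    then have "cmod (T (q x) - T (radial_stretch K u)) \<le> 10 * cmod (T x - T u) powr \<beta>"
      using core_rescale [OF k ji, of "h (x / of_real s) - u'" 10 "x - u"]
      by (simp add: Tdiff q_def ru u'_def s_def right_diff_distrib diff_divide_distrib)
    moreover have "cmod (T (radial_stretch K u) - T (radial_stretch K y))
        \<le> 4 * cmod (T u - T y) powr \<beta>"
      using u ys by (intro T_ann) auto
    moreover have "cmod (T x - T u) powr \<beta> \<le> cmod (T x - T y) powr \<beta>"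
      "cmod (T u - T y) powr \<beta> \<le> cmod (T x - T y) powr \<beta>"
      using dist_in_closed_segment [OF u(1)] holder_exponent_bounds pos
      by (auto intro!: powr_mono2 mult_left_mono
          simp: Tdiff norm_mult dist_norm norm_minus_commute)
    ultimately show ?thesis
      using norm_triangle_ineq [of "T (q x) - T (radial_stretch K u)"
          "T (radial_stretch K u) - T (radial_stretch K y)"] by simp
  qed
  consider "cmod x < s" "cmod y < s" | "cmod x < s" "s \<le> cmod y"
    | "s \<le> cmod x" "cmod y < s" | "s \<le> cmod x" "s \<le> cmod y" by linarith
  then show ?thesis
  proof cases
    case 1
    have "cmod (x / of_real s - y / of_real s) \<le> 2"
      using norm_triangle_ineq4 [of x y] 1 s
      by (simp add: norm_divide divide_le_eq flip: diff_divide_distrib)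
    then have "cmod (h (x / of_real s) - h (y / of_real s))
        \<le> 14 * cmod (x / of_real s - y / of_real s) powr \<beta>"
      using h by (simp add: distorts_well_def)
    then show ?thesis
      using core_rescale [OF k ji, of "h (x / of_real s) - h (y / of_real s)" 14 "x - y"] 1
      by (simp add: L_core Tdiff q_def s_def right_diff_distrib diff_divide_distrib)
  next
    case 2
    then show ?thesis using mixed [of x y] y by (simp add: L_core L_ann)
  next
    case 3
    then show ?thesis using mixed [of y x] x by (simp add: L_core L_ann norm_minus_commute)
  next
    case 4
    have "0 \<le> cmod (T x - T y) powr \<beta>" by simp
    then show ?thesis
      using T_ann [OF 4] unfolding L_ann [OF 4(1) x] L_ann [OF 4(2) y] by linarith
  qed
qed

text \<open>
  The constants do not deteriorate: only pairs in a common inner disk use the estimate for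
  \<open>h\<close> with constant 14, and they reproduce it exactly. Points of the unit circle are
  in no disk, so the bound towards it is a case of \<open>level_map_holder_separated\<close>.
\<close>

lemma level_map_distorts_well:
  assumes k: "1 \<le> k" and h: "distorts_well h"
  shows "distorts_well (level_map k h)"
proof -
  have h1: "cmod (h x) < 1" if "cmod x < 1" for x
    using h that by (simp add: distorts_well_def)
  have unit: "cmod x < 1" if "p \<in> index k" "x \<in> disk k p" for x p
    using disk_subset_unit [OF k, of "fst p" "snd p"] that by auto
  show ?thesis
    unfolding distorts_well_def
  proof (intro conjI allI impI)
    fix x :: complex assume x: "cmod x < 1"
    show "cmod (level_map k h x) < 1"
    proof (cases "\<exists>p\<in>index k. x \<in> disk k p")
      case True
      then obtain j i where ji: "(j, i) \<in> index k" "x \<in> disk k (j, i)" by auto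
      then have "level_map k h x \<in> disk k (j, i)"
        using k h1 by (intro level_map_in_disk)
      then show ?thesis using unit ji by blast
    next
      case False
      then show ?thesis using x by (subst level_map_outside) auto
    qed
    fix u :: complex assume u: "cmod u = 1"
    have u': "u \<notin> disk k p" if "p \<in> index k" for p
      using unit [OF that, of u] u by auto
    then have "level_map k h u = u" by (intro level_map_outside)
    moreover have "cmod (x - u) \<le> 2"
      using norm_triangle_ineq4 [of x u] x u by linarith
    ultimately show "cmod (level_map k h x - u) \<le> 10 * cmod (x - u) powr \<beta>"
      using level_map_holder_separated [of k h x u, OF k h1] u' by simp
  next
    fix x y :: complex assume xy: "cmod (x - y) \<le> 2"
    show "cmod (level_map k h x - level_map k h y) \<le> 14 * cmod (x - y) powr \<beta>"
    proof (cases "\<exists>p\<in>index k. x \<in> disk k p \<and> y \<in> disk k p")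
      case False
      then have "cmod (level_map k h x - level_map k h y) \<le> 10 * cmod (x - y) powr \<beta>"
        by (intro level_map_holder_separated k h1 xy) auto
      also have "\<dots> \<le> 14 * cmod (x - y) powr \<beta>" by simp
      finally show ?thesis .
    next
      case True
      then obtain j i where ji: "(j, i) \<in> index k" and "x \<in> disk k (j, i)" "y \<in> disk k (j, i)"
        by auto
      then obtain x' y' where x': "x = c k j i + of_real (R k j) * x'" "cmod x' < 1"
        and y': "y = c k j i + of_real (R k j) * y'" "cmod y' < 1"
        using disk_cases [OF k ji] by metis
      show ?thesis
        unfolding x' y' using x'(2) y'(2) by (rule same_disk_holder [OF k ji h])
    qed
  qed
qed

section \<open>Steps after a given one\<close>

text \<open>
  The map built from the \<open>d\<close> steps that follow step \<open>n\<close>, in the coordinate in which a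
  generating disk of generation \<open>n\<close> and its image are both the unit disk.
\<close>

primrec tail_map :: "nat \<Rightarrow> nat \<Rightarrow> complex \<Rightarrow> complex" where
  "tail_map 0 n = id"
| "tail_map (Suc d) n = level_map (Suc n) (tail_map d (Suc n))"

lemma tail_map_distorts_well: "distorts_well (tail_map d n)"
  by (induction d arbitrary: n) (auto simp: distorts_well_id intro: level_map_distorts_well)

lemma tail_map_holder: "cmod (x - y) < 1 \<Longrightarrow> cmod (tail_map d n x - tail_map d n y) \<le> 14 * cmod (x - y) powr \<beta>"
  using tail_map_distorts_well [of d n] by (simp add: distorts_well_def)

lemma level_map_contraction:
  assumes k: "1 \<le> k" and e: "\<And>x. cmod (h x - h' x) \<le> e"
  shows "cmod (level_map k h x - level_map k h' x) \<le> e / 100"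
proof -
  have e0: "0 \<le> e" using e [of 0] norm_ge_zero order_trans by blast
  show ?thesis
  proof (cases "\<exists>p\<in>index k. x \<in> disk k p")
    case False
    then have "level_map k h x = x" "level_map k h' x = x"
      by (auto intro: level_map_outside)
    then show ?thesis using e0 by simp
  next
    case True
    then obtain j i where ji: "(j, i) \<in> index k" "x \<in> disk k (j, i)" by auto
    obtain y where y: "x = c k j i + of_real (R k j) * y" "cmod y < 1"
      using disk_cases [OF k ji] by blast
    note pos = data_pos [OF k ji(1)]
    show ?thesis
    proof (cases "cmod y < \<sigma> k j powr K")
      case True
      let ?u = "y / of_real (\<sigma> k j powr K)"
      have "cmod (level_map k h x - level_map k h' x) = R k j * (\<sigma> k j * cmod (h ?u - h' ?u))"
        using True y pos level_map_disk [OF k ji(1) y(2)]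
        by (simp add: norm_mult flip: right_diff_distrib)
      also have "\<dots> \<le> 1 * (1 / 100 * e)"
        using pos e e0 by (intro mult_mono) auto
      finally show ?thesis by simp
    next
      case False
      then show ?thesis using y level_map_disk [OF k ji(1) y(2)] e0 by simp
    qed
  qed
qed

text \<open>
  Both maps agree up to depth \<open>d\<close>, and each level shrinks their difference by a factor
  \<open>\<sigma> R \<le> 1 / 100\<close>.
\<close>

lemma tail_map_increment: "cmod (tail_map (Suc d) n x - tail_map d n x) \<le> 2 * (1 / 100) ^ d"
proof (induction d arbitrary: n x)
  case 0
  show ?case
  proof (cases "\<exists>p\<in>index (Suc n). x \<in> disk (Suc n) p")
    case False
    then show ?thesis by (auto simp: level_map_outside)
  next
    case True
    then obtain j i where ji: "(j, i) \<in> index (Suc n)" "x \<in> disk (Suc n) (j, i)" by auto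
    have "level_map (Suc n) id x \<in> disk (Suc n) (j, i)"
      using ji by (intro level_map_in_disk) auto
    then have "cmod (level_map (Suc n) id x) < 1" "cmod x < 1"
      using ji disk_subset_unit [of "Suc n" j i] by auto
    then show ?thesis
      using norm_triangle_ineq4 [of "level_map (Suc n) id x" x] by simp
  qed
next
  case (Suc d)
  show ?case
    using level_map_contraction [of "Suc n" "tail_map (Suc d) (Suc n)" "tail_map d (Suc n)", OF _ Suc.IH]
    by (simp add: mult.commute)
qed

lemma convergent_tail_map: "convergent (\<lambda>d. tail_map d n x)"
proof -
  have "summable (\<lambda>d. tail_map (Suc d) n x - tail_map d n x)"
  proof (rule summable_comparison_test')
    show "summable (\<lambda>d. 2 * (1 / 100) ^ d :: real)"
      by (intro summable_mult summable_geometric) simp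
  qed (rule tail_map_increment)
  then have "convergent (\<lambda>d. tail_map d n x - tail_map 0 n x)"
    unfolding summable_iff_convergent sum_lessThan_telescope [of "\<lambda>d. tail_map d n x"] .
  then have "convergent (\<lambda>d. (tail_map d n x - tail_map 0 n x) + tail_map 0 n x)"
    by (intro convergent_add convergent_const)
  then show ?thesis by simp
qed

section \<open>Multiindices and nested similarities\<close>

definition psi :: "nat \<Rightarrow> nat \<Rightarrow> nat \<Rightarrow> complex \<Rightarrow> complex" where
  "psi k j i z = c k j i + complex_of_real (\<sigma> k j * R k j) * z"

primrec psi_comp :: "nat \<Rightarrow> (nat \<Rightarrow> nat) \<times> (nat \<Rightarrow> nat) \<Rightarrow> complex \<Rightarrow> complex" where
  "psi_comp 0 IJ = id"
| "psi_comp (Suc n) IJ = psi_comp n IJ \<circ> psi (Suc n) (snd IJ (Suc n)) (fst IJ (Suc n))"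

text \<open>
  Membership in \<open>multi_indices n\<close> requires functions that are undefined outside \<open>{1..n}\<close>, which
  is not preserved when \<open>n\<close> changes. The proofs by induction on the generation use the following
  two relations, which see only the entries up to \<open>n\<close>.
\<close>

definition valid :: "nat \<Rightarrow> (nat \<Rightarrow> nat) \<times> (nat \<Rightarrow> nat) \<Rightarrow> bool" where
  "valid n IJ \<longleftrightarrow> (\<forall>k\<in>{1..n}. (snd IJ k, fst IJ k) \<in> index k)"

definition agree :: "nat \<Rightarrow> (nat \<Rightarrow> nat) \<times> (nat \<Rightarrow> nat) \<Rightarrow> (nat \<Rightarrow> nat) \<times> (nat \<Rightarrow> nat) \<Rightarrow> bool" where
  "agree n IJ IJ' \<longleftrightarrow> (\<forall>k\<in>{1..n}. fst IJ k = fst IJ' k \<and> snd IJ k = snd IJ' k)"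

lemma valid_Suc: "valid (Suc n) IJ \<longleftrightarrow> valid n IJ \<and> (snd IJ (Suc n), fst IJ (Suc n)) \<in> index (Suc n)"
  by (auto simp: valid_def atLeastAtMostSuc_conv)

lemma agree_Suc: "agree (Suc n) IJ IJ' \<longleftrightarrow>
    agree n IJ IJ' \<and> fst IJ (Suc n) = fst IJ' (Suc n) \<and> snd IJ (Suc n) = snd IJ' (Suc n)"
  by (auto simp: agree_def atLeastAtMostSuc_conv)

lemma agree_comp:
  assumes "agree n IJ IJ'"
  shows "sim_comp n IJ = sim_comp n IJ'" "psi_comp n IJ = psi_comp n IJ'"
  using assms by (induction n) (auto simp: agree_Suc)

lemma multi_indices_valid: "IJ \<in> multi_indices n \<Longrightarrow> valid n IJ"
  by (auto simp: multi_indices_def valid_def index_def PiE_iff)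

lemma multi_indices_eq:
  assumes "IJ \<in> multi_indices n" "IJ' \<in> multi_indices n" "agree n IJ IJ'"
  shows "IJ = IJ'"
proof (rule prod_eqI)
  show snd: "snd IJ = snd IJ'"
    using assms by (intro PiE_ext [of "snd IJ" "{1..n}" "\<lambda>k. {1..l k}" "snd IJ'"])
      (auto simp: multi_indices_def agree_def)
  show "fst IJ = fst IJ'"
    using assms snd
    by (intro PiE_ext [of "fst IJ" "{1..n}" "\<lambda>k. {1..m k (snd IJ k)}" "fst IJ'"])
      (auto simp: multi_indices_def agree_def)
qed

lemma valid_obtain_multi_index:
  assumes "valid n IJ"
  obtains IJ' where "IJ' \<in> multi_indices n" "agree n IJ IJ'"
proof
  show "(restrict (fst IJ) {1..n}, restrict (snd IJ) {1..n}) \<in> multi_indices n"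
    using assms by (auto simp: multi_indices_def valid_def index_def PiE_iff)
  show "agree n IJ (restrict (fst IJ) {1..n}, restrict (snd IJ) {1..n})"
    by (auto simp: agree_def)
qed

lemma valid_extend:
  assumes "valid n IJ" "(j, i) \<in> index (Suc n)"
  obtains IJ' where "valid (Suc n) IJ'" "agree n IJ IJ'" "snd IJ' (Suc n) = j" "fst IJ' (Suc n) = i"
proof
  let ?IJ = "((fst IJ)(Suc n := i), (snd IJ)(Suc n := j))"
  show "valid (Suc n) ?IJ" using assms by (auto simp: valid_def)
  show "agree n IJ ?IJ" by (auto simp: agree_def)
qed auto

lemma sim_comp_affine:
  "sim_comp n IJ w = sim_comp n IJ 0
     + of_real (\<Prod>k\<in>{1..n}. \<sigma> k (snd IJ k) powr K * R k (snd IJ k)) * w"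
proof (induction n arbitrary: w)
  case (Suc n)
  define a where "a = (\<Prod>k\<in>{1..n}. \<sigma> k (snd IJ k) powr K * R k (snd IJ k))"
  have a_Suc: "(\<Prod>k\<in>{1..Suc n}. \<sigma> k (snd IJ k) powr K * R k (snd IJ k))
      = a * (\<sigma> (Suc n) (snd IJ (Suc n)) powr K * R (Suc n) (snd IJ (Suc n)))"
    by (simp add: a_def)
  note IH = Suc.IH [folded a_def]
  show ?case
    using IH [of "sim (Suc n) (snd IJ (Suc n)) (fst IJ (Suc n)) w"]
      IH [of "sim (Suc n) (snd IJ (Suc n)) (fst IJ (Suc n)) 0"]
    unfolding a_Suc
    by (simp add: sim_def algebra_simps)
qed simp

lemma psi_comp_affine:
  "psi_comp n IJ w = psi_comp n IJ 0
     + of_real (\<Prod>k\<in>{1..n}. \<sigma> k (snd IJ k) * R k (snd IJ k)) * w"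
proof (induction n arbitrary: w)
  case (Suc n)
  define a where "a = (\<Prod>k\<in>{1..n}. \<sigma> k (snd IJ k) * R k (snd IJ k))"
  have a_Suc: "(\<Prod>k\<in>{1..Suc n}. \<sigma> k (snd IJ k) * R k (snd IJ k))
      = a * (\<sigma> (Suc n) (snd IJ (Suc n)) * R (Suc n) (snd IJ (Suc n)))"
    by (simp add: a_def)
  note IH = Suc.IH [folded a_def]
  show ?case
    using IH [of "psi (Suc n) (snd IJ (Suc n)) (fst IJ (Suc n)) w"]
      IH [of "psi (Suc n) (snd IJ (Suc n)) (fst IJ (Suc n)) 0"]
    unfolding a_Suc
    by (simp add: psi_def algebra_simps)
qed simp

text \<open>
  The coordinate of the disk of step \<open>n + 1\<close> selected by \<open>IJ\<close>, as in \<open>level_map_disk\<close>. The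
  image of the unit disk under \<open>sim_comp n IJ \<circ> chart n IJ\<close> is the protecting disk of generation \<open>n + 1\<close>.
\<close>

abbreviation chart :: "nat \<Rightarrow> (nat \<Rightarrow> nat) \<times> (nat \<Rightarrow> nat) \<Rightarrow> complex \<Rightarrow> complex" where
  "chart n IJ y \<equiv> c (Suc n) (snd IJ (Suc n)) (fst IJ (Suc n))
     + of_real (R (Suc n) (snd IJ (Suc n))) * y"

lemma chart_in_disk:
  assumes "valid (Suc n) IJ" "cmod y < 1"
  shows "chart n IJ y \<in> disk (Suc n) (snd IJ (Suc n), fst IJ (Suc n))" "cmod (chart n IJ y) < 1"
proof -
  have ji: "(snd IJ (Suc n), fst IJ (Suc n)) \<in> index (Suc n)"
    using assms by (simp add: valid_Suc)
  show 1: "chart n IJ y \<in> disk (Suc n) (snd IJ (Suc n), fst IJ (Suc n))"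
    using assms(2) data_pos [OF _ ji] by (simp add: disk_def dist_norm norm_mult)
  show "cmod (chart n IJ y) < 1"
    using 1 disk_subset_unit [OF _ ji] by auto
qed

lemma chart_unique:
  assumes v: "valid (Suc n) IJ" "valid (Suc n) IJ'" and y: "cmod y < 1" "cmod y' < 1"
    and eq: "chart n IJ y = chart n IJ' y'" and ag: "agree n IJ IJ'"
  shows "agree (Suc n) IJ IJ'" "y = y'"
proof -
  have "(snd IJ (Suc n), fst IJ (Suc n)) = (snd IJ' (Suc n), fst IJ' (Suc n))"
    using v chart_in_disk(1) [OF v(1) y(1)] chart_in_disk(1) [OF v(2) y(2)] eq
    by (intro disk_unique [of "Suc n"]) (auto simp: valid_Suc)
  then show "agree (Suc n) IJ IJ'" "y = y'"
    using ag eq data_pos [of "Suc n" "snd IJ (Suc n)" "fst IJ (Suc n)"] v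
    by (auto simp: agree_Suc valid_Suc)
qed

lemma core_in_disk:
  assumes "valid (Suc n) IJ" "cmod x < 1"
  shows "cmod (of_real (\<sigma> (Suc n) (snd IJ (Suc n)) powr K) * x) < 1"
    "cmod (of_real (\<sigma> (Suc n) (snd IJ (Suc n))) * x) < 1"
proof -
  have ji: "(snd IJ (Suc n), fst IJ (Suc n)) \<in> index (Suc n)"
    using assms by (simp add: valid_Suc)
  have "s * cmod x < 1" if "0 < s" "s < 1" for s
    using mult_strict_mono [of s 1 "cmod x" 1] assms(2) that by simp
  then show "cmod (of_real (\<sigma> (Suc n) (snd IJ (Suc n)) powr K) * x) < 1"
    "cmod (of_real (\<sigma> (Suc n) (snd IJ (Suc n))) * x) < 1"
    using data_pos [OF _ ji] core_scale [OF _ ji] by (auto simp: norm_mult)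
qed

lemma sim_comp_Suc_chart:
  "sim_comp (Suc n) IJ x = sim_comp n IJ
     (chart n IJ (of_real (\<sigma> (Suc n) (snd IJ (Suc n)) powr K) * x))"
  by (simp add: sim_def mult_ac)

lemma psi_comp_Suc_chart:
  "psi_comp (Suc n) IJ x = psi_comp n IJ
     (chart n IJ (of_real (\<sigma> (Suc n) (snd IJ (Suc n))) * x))"
  by (simp add: psi_def mult_ac)

text \<open>
  The image disks of one generation are pairwise disjoint, because each lies in the disk of the
  same step inside its parent.
\<close>

lemma psi_comp_unique:
  assumes "valid n IJ" "valid n IJ'" "cmod x < 1" "cmod x' < 1"
    and "psi_comp n IJ x = psi_comp n IJ' x'"
  shows "agree n IJ IJ' \<and> x = x'"
  using assms
proof (induction n arbitrary: x x')
  case 0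
  then show ?case by (simp add: agree_def)
next
  case (Suc n)
  let ?s = "complex_of_real (\<sigma> (Suc n) (snd IJ (Suc n)))"
  let ?s' = "complex_of_real (\<sigma> (Suc n) (snd IJ' (Suc n)))"
  have ag: "agree n IJ IJ'" and eq: "chart n IJ (?s * x) = chart n IJ' (?s' * x')"
    using Suc.IH [of "chart n IJ (?s * x)" "chart n IJ' (?s' * x')"] Suc.prems
      chart_in_disk(2) core_in_disk(2)
    by (auto simp only: valid_Suc psi_comp_Suc_chart)
  have "agree (Suc n) IJ IJ'" "?s * x = ?s' * x'"
    using chart_unique [OF Suc.prems(1,2) _ _ eq ag] core_in_disk(2) Suc.prems by blast+
  then show ?case
    using data_pos [of "Suc n" "snd IJ (Suc n)" "fst IJ (Suc n)"] Suc.prems(1)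
    by (auto simp: agree_Suc valid_Suc)
qed

lemma gen_disk_Suc:
  "gen_disk (Suc n) IJ =
     (\<lambda>y. sim_comp n IJ (chart n IJ (of_real (\<sigma> (Suc n) (snd IJ (Suc n)) powr K) * y))) ` ball 0 1"
  unfolding gen_disk_def sim_comp_Suc_chart ..

lemma prot_disk_Suc:
  assumes v: "valid (Suc n) IJ"
  shows "prot_disk (Suc n) IJ = (\<lambda>y. sim_comp n IJ (chart n IJ y)) ` ball 0 1"
proof -
  define s where "s = \<sigma> (Suc n) (snd IJ (Suc n)) powr K"
  have s: "s \<noteq> 0"
    using core_scale [of "Suc n" "snd IJ (Suc n)" "fst IJ (Suc n)"] v by (simp add: valid_Suc s_def)
  have "sim_comp n IJ (chart n IJ 0)
      + (1 / s) *\<^sub>R (sim_comp n IJ (chart n IJ (of_real s * y)) - sim_comp n IJ (chart n IJ 0))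
      = sim_comp n IJ (chart n IJ y)" for y
    using s by (simp add: sim_comp_affine [of n IJ "_ + _"] sim_comp_affine [of n IJ "c _ _ _"]
        scaleR_conv_of_real field_simps)
  then show ?thesis
    by (simp add: prot_disk_def gen_disk_Suc image_image sim_comp_Suc_chart s_def
        del: sim_comp.simps)
qed

section \<open>The maps of the construction as tail maps\<close>

lemma affine_image_ball:
  fixes a :: complex
  assumes "0 < r"
  shows "(\<lambda>y. a + of_real r * y) ` ball 0 1 = ball a r"
proof (intro equalityI subsetI)
  fix x assume "x \<in> ball a r"
  then show "x \<in> (\<lambda>y. a + of_real r * y) ` ball 0 1"
    using assms by (intro image_eqI [of _ _ "(x - a) / of_real r"])
      (auto simp: dist_norm norm_divide norm_minus_commute)
qed (use assms in \<open>auto simp: dist_norm norm_mult\<close>)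

text \<open>
  The implication from right to left says what \<open>phi n\<close> does on generating disks. The converse
  says that nothing else is mapped into their images; it is what replaces injectivity of \<open>phi n\<close>
  when one decides whether \<open>phi n z\<close> lies in the image of a protecting disk.
\<close>

definition conjugates :: "nat \<Rightarrow> bool" where
  "conjugates n \<longleftrightarrow> (\<forall>IJ x z. valid n IJ \<longrightarrow> cmod x < 1 \<longrightarrow>
     (phi n z = psi_comp n IJ x \<longleftrightarrow> z = sim_comp n IJ x))"

lemma conjugatesD:
  "conjugates n \<Longrightarrow> valid n IJ \<Longrightarrow> cmod x < 1 \<Longrightarrow> phi n z = psi_comp n IJ x \<longleftrightarrow> z = sim_comp n IJ x"
  unfolding conjugates_def by blast

lemma sim_comp_unique:
  assumes "conjugates n" "valid n IJ" "valid n IJ'" "cmod x < 1" "cmod x' < 1"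
    and "sim_comp n IJ x = sim_comp n IJ' x'"
  shows "agree n IJ IJ' \<and> x = x'"
  using psi_comp_unique [OF assms(2-5)] conjugatesD [OF assms(1)] assms by metis

lemma phi_image_disks:
  assumes Q: "conjugates n" and v: "valid (Suc n) IJ"
  shows "phi n ` prot_disk (Suc n) IJ = (\<lambda>y. psi_comp n IJ (chart n IJ y)) ` ball 0 1"
    and "phi n ` gen_disk (Suc n) IJ =
      (\<lambda>y. psi_comp n IJ
        (chart n IJ (of_real (\<sigma> (Suc n) (snd IJ (Suc n)) powr K) * y))) ` ball 0 1"
proof -
  have *: "phi n (sim_comp n IJ (chart n IJ y)) = psi_comp n IJ (chart n IJ y)" if "cmod y < 1" for y
    using conjugatesD [OF Q] v that chart_in_disk(2) by (simp add: valid_Suc)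
  then show "phi n ` prot_disk (Suc n) IJ = (\<lambda>y. psi_comp n IJ (chart n IJ y)) ` ball 0 1"
    unfolding prot_disk_Suc [OF v] image_image by (intro image_cong) auto
  show "phi n ` gen_disk (Suc n) IJ =
      (\<lambda>y. psi_comp n IJ
        (chart n IJ (of_real (\<sigma> (Suc n) (snd IJ (Suc n)) powr K) * y))) ` ball 0 1"
    unfolding gen_disk_Suc image_image using core_in_disk(1) [OF v]
    by (intro image_cong * refl) simp
qed

lemma psi_chart_affine:
  "psi_comp n IJ (chart n IJ y) = psi_comp n IJ (chart n IJ 0) + of_real (img_radius (Suc n) IJ) * y"
proof -
  define a where "a = (\<Prod>k\<in>{1..n}. \<sigma> k (snd IJ k) * R k (snd IJ k))"
  have r: "img_radius (Suc n) IJ = a * R (Suc n) (snd IJ (Suc n))"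
    by (simp add: img_radius_def a_def prod.distrib atLeastLessThanSuc_atLeastAtMost)
  show ?thesis
    using psi_comp_affine [of n IJ "chart n IJ y"] psi_comp_affine [of n IJ "chart n IJ 0"]
    unfolding r a_def [symmetric] by (simp add: algebra_simps)
qed

lemma img_radius_pos:
  assumes "valid n IJ" shows "0 < img_radius n IJ"
proof -
  have "0 < R k (snd IJ k) \<and> 0 < \<sigma> k (snd IJ k)" if "k \<in> {1..n}" for k
    using that assms data_pos [of k "snd IJ k" "fst IJ k"] by (auto simp: valid_def)
  then show ?thesis
    by (auto simp: img_radius_def intro!: mult_pos_pos prod_pos)
qed

lemma img_centre_eq:
  assumes Q: "conjugates n" and v: "valid (Suc n) IJ"
  shows "img_centre (Suc n) (phi n) IJ = psi_comp n IJ (chart n IJ 0)"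
proof -
  have "phi n ` prot_disk (Suc n) IJ = ball (psi_comp n IJ (chart n IJ 0)) (img_radius (Suc n) IJ)"
    unfolding phi_image_disks(1) [OF Q v]
    using affine_image_ball [OF img_radius_pos [OF v]]
    by (subst psi_chart_affine) simp
  then show ?thesis
    using img_radius_pos [OF v] by (auto simp: img_centre_def ball_eq_ball_iff)
qed

text \<open>
  In the coordinate \<open>chart\<close>, the map \<open>g\<close> is the level map with the identity inserted. Disjointness
  of the image disks determines the multiindex in the definition of \<open>g\<close>.
\<close>

lemma phi_Suc_on_prot_disk:
  assumes Q: "conjugates n" and v: "valid (Suc n) IJ" and y: "cmod y < 1"
  shows "phi (Suc n) (sim_comp n IJ (chart n IJ y)) =
      psi_comp n IJ (level_map (Suc n) id (chart n IJ y))"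
proof -
  have main: "phi (Suc n) (sim_comp n IJ (chart n IJ y)) =
      psi_comp n IJ (level_map (Suc n) id (chart n IJ y))"
    if IJ: "IJ \<in> multi_indices (Suc n)" for IJ
  proof -
    note v = multi_indices_valid [OF IJ]
    have vn: "valid n IJ" and ji: "(snd IJ (Suc n), fst IJ (Suc n)) \<in> index (Suc n)"
      using v by (simp_all add: valid_Suc)
    note pos = data_pos [OF _ ji] core_scale [OF _ ji]
    let ?w = "psi_comp n IJ (chart n IJ y)"
    have w: "phi n (sim_comp n IJ (chart n IJ y)) = ?w"
      using conjugatesD [OF Q vn] chart_in_disk(2) [OF v y] by simp
    have mem: "?w \<in> phi n ` prot_disk (Suc n) IJ"
      using y by (auto simp: phi_image_disks(1) [OF Q v])
    have uniq: "IJ' = IJ" if IJ': "IJ' \<in> multi_indices (Suc n)" "?w \<in> phi n ` prot_disk (Suc n) IJ'" for IJ'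
    proof -
      note v' = multi_indices_valid [OF IJ'(1)]
      obtain y' where y': "cmod y' < 1" "?w = psi_comp n IJ' (chart n IJ' y')"
        using IJ'(2) by (auto simp: phi_image_disks(1) [OF Q v'])
      have "agree n IJ IJ' \<and> chart n IJ y = chart n IJ' y'"
        using v v' y y' chart_in_disk(2) by (intro psi_comp_unique) (auto simp: valid_Suc)
      then have "agree (Suc n) IJ IJ'"
        using chart_unique(1) [OF v v' y y'(1)] by blast
      then show ?thesis using multi_indices_eq [OF IJ IJ'(1)] by simp
    qed
    have the: "(THE IJ. IJ \<in> multi_indices (Suc n) \<and> ?w \<in> phi n ` prot_disk (Suc n) IJ) = IJ"
      using IJ mem uniq by blast
    have gen: "?w \<in> phi n ` gen_disk (Suc n) IJ \<longleftrightarrow> cmod y < \<sigma> (Suc n) (snd IJ (Suc n)) powr K"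
    proof
      assume "?w \<in> phi n ` gen_disk (Suc n) IJ"
      then obtain x where "cmod x < 1"
        "?w = psi_comp n IJ (chart n IJ (of_real (\<sigma> (Suc n) (snd IJ (Suc n)) powr K) * x))"
        by (auto simp: phi_image_disks(2) [OF Q v])
      then have "y = of_real (\<sigma> (Suc n) (snd IJ (Suc n)) powr K) * x" "cmod x < 1"
        using img_radius_pos [OF v] psi_chart_affine [of n IJ y]
          psi_chart_affine [of n IJ "of_real (\<sigma> (Suc n) (snd IJ (Suc n)) powr K) * x"] by auto
      then show "cmod y < \<sigma> (Suc n) (snd IJ (Suc n)) powr K"
        using pos by (simp add: norm_mult)
    next
      assume "cmod y < \<sigma> (Suc n) (snd IJ (Suc n)) powr K"
      then show "?w \<in> phi n ` gen_disk (Suc n) IJ"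
        unfolding phi_image_disks(2) [OF Q v] using pos
        by (intro image_eqI [of _ _ "y / of_real (\<sigma> (Suc n) (snd IJ (Suc n)) powr K)"])
          (auto simp: norm_divide)
    qed
    define r where "r = img_radius (Suc n) IJ"
    define x where "x = img_centre (Suc n) (phi n) IJ"
    have r: "0 < r" using img_radius_pos [OF v] by (simp add: r_def)
    have aff: "psi_comp n IJ (chart n IJ y) = x + of_real r * y" for y
      unfolding x_def r_def img_centre_eq [OF Q v] by (rule psi_chart_affine)
    have "phi (Suc n) (sim_comp n IJ (chart n IJ y)) = g (Suc n) (phi n) ?w"
      by (simp add: w)
    also have "\<dots> = (if cmod y < \<sigma> (Suc n) (snd IJ (Suc n)) powr K
        then (\<sigma> (Suc n) (snd IJ (Suc n)) powr (1 - K)) *\<^sub>R (?w - x) + x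
        else (cmod ((?w - x) / complex_of_real r) powr (1 / K - 1)) *\<^sub>R (?w - x) + x)"
      using IJ mem gen unfolding g_def the Let_def r_def x_def by auto
    also have "\<dots> = x + of_real r * (if cmod y < \<sigma> (Suc n) (snd IJ (Suc n)) powr K
        then of_real (\<sigma> (Suc n) (snd IJ (Suc n)) powr (1 - K)) * y else radial_stretch K y)"
      using r by (simp add: aff radial_stretch_def scaleR_conv_of_real)
    also have "of_real (\<sigma> (Suc n) (snd IJ (Suc n)) powr (1 - K)) * y
        = of_real (\<sigma> (Suc n) (snd IJ (Suc n))) * id (y / of_real (\<sigma> (Suc n) (snd IJ (Suc n)) powr K))"
      using pos by (simp add: powr_diff)
    also note aff [symmetric]
    also note level_map_disk [OF _ ji y, of id, symmetric]
    finally show ?thesis by simp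
  qed
  obtain IJ' where IJ': "IJ' \<in> multi_indices (Suc n)" "agree (Suc n) IJ IJ'"
    using v by (rule valid_obtain_multi_index)
  then show ?thesis using main [OF IJ'(1)] agree_comp [of n IJ IJ'] by (simp add: agree_Suc)
qed

lemma phi_Suc_outside:
  assumes Q: "conjugates n"
    and z: "\<And>IJ y. valid (Suc n) IJ \<Longrightarrow> cmod y < 1 \<Longrightarrow> z \<noteq> sim_comp n IJ (chart n IJ y)"
  shows "phi (Suc n) z = phi n z"
proof -
  have "phi n z \<notin> phi n ` prot_disk (Suc n) IJ" if "IJ \<in> multi_indices (Suc n)" for IJ
  proof
    note v = multi_indices_valid [OF that]
    assume "phi n z \<in> phi n ` prot_disk (Suc n) IJ"
    then obtain y where y: "cmod y < 1" "phi n z = psi_comp n IJ (chart n IJ y)"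
      by (auto simp: phi_image_disks(1) [OF Q v])
    then have "z = sim_comp n IJ (chart n IJ y)"
      using conjugatesD [OF Q, of IJ "chart n IJ y" z] v chart_in_disk(2) [OF v y(1)]
      by (simp add: valid_Suc)
    then show False using z v y by blast
  qed
  then show ?thesis by (simp add: g_def)
qed

text \<open>
  For the converse direction: a point outside all protecting disks of generation \<open>n + 1\<close> keeps its
  value, hence by induction it cannot reach the image of such a disk; a point inside one stays in
  its image, so the multiindices agree, and the stretching preserves the order of moduli.
\<close>

lemma conjugates_step:
  assumes Q: "conjugates n"
  shows "conjugates (Suc n)"
  unfolding conjugates_def
proof (intro allI impI)
  fix IJ x z
  assume v: "valid (Suc n) IJ" and x: "cmod x < 1"
  have vn: "valid n IJ" and ji: "(snd IJ (Suc n), fst IJ (Suc n)) \<in> index (Suc n)"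
    using v by (simp_all add: valid_Suc)
  define s where "s = \<sigma> (Suc n) (snd IJ (Suc n))"
  have s: "0 < s" "0 < s powr K"
    using data_pos [OF _ ji] by (auto simp: s_def)
  have sx: "cmod (of_real (s powr K) * x) < 1" "cmod (of_real s * x) < 1"
    using core_in_disk [OF v x] by (auto simp: s_def)
  have level: "level_map (Suc n) id (chart n IJ (of_real (s powr K) * x)) = chart n IJ (of_real s * x)"
    using level_map_disk [OF _ ji sx(1), of id] x s by (simp add: norm_mult flip: s_def)
  show "phi (Suc n) z = psi_comp (Suc n) IJ x \<longleftrightarrow> z = sim_comp (Suc n) IJ x"
  proof
    assume "z = sim_comp (Suc n) IJ x"
    then show "phi (Suc n) z = psi_comp (Suc n) IJ x"
      unfolding sim_comp_Suc_chart psi_comp_Suc_chart s_def [symmetric]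
      using phi_Suc_on_prot_disk [OF Q v sx(1)] level by simp
  next
    assume eq: "phi (Suc n) z = psi_comp (Suc n) IJ x"
    show "z = sim_comp (Suc n) IJ x"
    proof (cases "\<exists>IJ' y. valid (Suc n) IJ' \<and> cmod y < 1 \<and> z = sim_comp n IJ' (chart n IJ' y)")
      case False
      then have "phi n z = psi_comp n IJ (chart n IJ (of_real s * x))"
        using phi_Suc_outside [OF Q, of z] eq unfolding psi_comp_Suc_chart s_def by metis
      then have "z = sim_comp n IJ (chart n IJ (of_real s * x))"
        using conjugatesD [OF Q vn] chart_in_disk(2) [OF v sx(2)] by blast
      then show ?thesis using False v sx(2) by blast
    next
      case True
      then obtain IJ' y where v': "valid (Suc n) IJ'" and y: "cmod y < 1"
        and z: "z = sim_comp n IJ' (chart n IJ' y)" by blast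
      have ji': "(snd IJ' (Suc n), fst IJ' (Suc n)) \<in> index (Suc n)"
        using v' by (simp add: valid_Suc)
      have "level_map (Suc n) id (chart n IJ' y) \<in> disk (Suc n) (snd IJ' (Suc n), fst IJ' (Suc n))"
        using chart_in_disk(1) [OF v' y] ji' by (intro level_map_in_disk) auto
      then obtain y' where y': "level_map (Suc n) id (chart n IJ' y) = chart n IJ' y'" "cmod y' < 1"
        using disk_cases [OF _ ji'] by auto
      have "psi_comp n IJ' (chart n IJ' y') = psi_comp n IJ (chart n IJ (of_real s * x))"
        using eq phi_Suc_on_prot_disk [OF Q v' y] unfolding z y' psi_comp_Suc_chart s_def by simp
      then have *: "agree n IJ' IJ \<and> chart n IJ' y' = chart n IJ (of_real s * x)"
        using v v' chart_in_disk(2) y'(2) sx(2) by (intro psi_comp_unique) (auto simp: valid_Suc)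
      then have ag: "agree (Suc n) IJ' IJ" and y'x: "y' = of_real s * x"
        using chart_unique [OF v' v y'(2) sx(2)] by blast+
      have ch: "chart n IJ' = chart n IJ" and sc: "sim_comp n IJ' = sim_comp n IJ"
        using ag agree_comp by (auto simp: agree_Suc)
      have lv: "(if cmod y < s powr K then of_real s * (y / of_real (s powr K)) else radial_stretch K y) = of_real s * x"
        using y'(1) level_map_disk [OF _ ji y, of id] data_pos [OF _ ji] y'x
        unfolding fun_cong [OF ch] s_def by (simp split: if_splits)
      have "y = of_real (s powr K) * x"
      proof (cases "cmod y < s powr K")
        case True
        then show ?thesis using lv s by (simp add: field_simps)
      next
        case False
        then have "cmod y powr (1 / K) < s"
          using lv norm_radial_stretch [of K y] mult_strict_left_mono [of "cmod x" 1 s] s x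
          by (simp add: norm_mult)
        then have "cmod y < s powr K"
          using powr_less_mono2 [of K "cmod y powr (1 / K)" s] K_gt_1 by (simp add: powr_powr)
        with False show ?thesis by simp
      qed
      then show ?thesis
        unfolding z sim_comp_Suc_chart s_def [symmetric] fun_cong [OF ch] sc by simp
    qed
  qed
qed

lemma conjugates_all: "conjugates n"
proof (induction n)
  case 0
  show ?case by (simp add: conjugates_def)
qed (rule conjugates_step)

text \<open>
  All later changes take place inside protecting disks of later generations, which lie in
  generating disks of generation \<open>n\<close>.
\<close>

lemma phi_stable:
  assumes "\<And>IJ x. valid n IJ \<Longrightarrow> cmod x < 1 \<Longrightarrow> z \<noteq> sim_comp n IJ x"
  shows "phi (n + d) z = phi n z"
  using assms
proof (induction d arbitrary: n)
  case (Suc d)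
  have *: "z \<noteq> sim_comp n IJ (chart n IJ y)" if "valid (Suc n) IJ" "cmod y < 1" for IJ y
    using that chart_in_disk(2) [OF that] by (intro Suc.prems) (auto simp: valid_Suc)
  have "phi (Suc n) z = phi n z"
    by (intro phi_Suc_outside conjugates_all *)
  moreover have "phi (Suc n + d) z = phi (Suc n) z"
    by (rule Suc.IH) (metis sim_comp_Suc_chart core_in_disk(1) *)
  ultimately show ?case by (simp del: phi.simps)
qed simp

text \<open>
  The self-similar structure of the construction. By induction on \<open>d\<close>, following a point into the
  disks of step \<open>n + 1\<close>: outside them and on the annuli the value is final after step \<open>n + 1\<close>,
  and in an inner disk the induction hypothesis applies in generation \<open>n + 1\<close>.
\<close>

lemma phi_add:
  assumes "valid n IJ" "cmod x < 1"
  shows "phi (n + d) (sim_comp n IJ x) = psi_comp n IJ (tail_map d n x)"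
  using assms
proof (induction d arbitrary: n IJ x)
  case 0
  then show ?case using conjugatesD [OF conjugates_all] by simp
next
  case (Suc d)
  note Q = conjugates_all [of n] and v = Suc.prems(1) and x = Suc.prems(2)
  let ?z = "sim_comp n IJ x"
  have stop: "phi (n + Suc d) ?z = phi (Suc n) ?z"
    if "\<And>IJ' y. valid (Suc n) IJ' \<Longrightarrow> cmod y < 1 \<Longrightarrow> ?z \<noteq> sim_comp (Suc n) IJ' y"
    using phi_stable [of "Suc n" ?z d] that by (simp del: phi.simps sim_comp.simps)
  have located: "agree n IJ IJ' \<and> x = chart n IJ' y"
    if "valid (Suc n) IJ'" "cmod y < 1" "?z = sim_comp n IJ' (chart n IJ' y)" for IJ' y
    using sim_comp_unique [OF Q v, of IJ' x "chart n IJ' y"] that x chart_in_disk(2)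
    by (simp add: valid_Suc)
  show ?case
  proof (cases "\<exists>p\<in>index (Suc n). x \<in> disk (Suc n) p")
    case False
    have out: "?z \<noteq> sim_comp n IJ' (chart n IJ' y)" if "valid (Suc n) IJ'" "cmod y < 1" for IJ' y
      using located [OF that] chart_in_disk(1) [OF that] that False by (auto simp: valid_Suc)
    have "phi (n + Suc d) ?z = phi (Suc n) ?z"
      by (rule stop) (metis sim_comp_Suc_chart core_in_disk(1) out)
    also have "\<dots> = phi n ?z" by (intro phi_Suc_outside Q out)
    also have "\<dots> = psi_comp n IJ x" using conjugatesD [OF Q v x] by simp
    finally show ?thesis using False level_map_outside [of "Suc n" x] by auto
  next
    case True
    then obtain j i where ji: "(j, i) \<in> index (Suc n)" "x \<in> disk (Suc n) (j, i)" by auto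
    obtain IJ' where v': "valid (Suc n) IJ'" and ag: "agree n IJ IJ'"
      and IJ': "snd IJ' (Suc n) = j" "fst IJ' (Suc n) = i"
      using valid_extend [OF v ji(1)] .
    obtain y where y: "x = chart n IJ' y" "cmod y < 1"
      using disk_cases [OF _ ji] IJ' by auto
    define s where "s = \<sigma> (Suc n) j"
    have s: "0 < s" "0 < s powr K"
      using data_pos [OF _ ji(1)] by (auto simp: s_def)
    note comp = agree_comp [OF ag]
    note L = level_map_disk [OF _ ji(1) y(2), folded s_def]
    show ?thesis
    proof (cases "cmod y < s powr K")
      case True
      let ?u = "y / of_real (s powr K)"
      have u: "cmod ?u < 1" using True s by (simp add: norm_divide)
      have "?z = sim_comp (Suc n) IJ' ?u"
        unfolding sim_comp_Suc_chart comp y(1) using s by (simp add: IJ' flip: s_def)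
      then have "phi (n + Suc d) ?z = psi_comp (Suc n) IJ' (tail_map d (Suc n) ?u)"
        using Suc.IH [OF v' u] by (simp del: phi.simps sim_comp.simps psi_comp.simps)
      also have "\<dots> = psi_comp n IJ (tail_map (Suc d) n x)"
        unfolding psi_comp_Suc_chart comp using True L [of "tail_map d (Suc n)"]
        by (simp add: y(1) IJ' flip: s_def)
      finally show ?thesis .
    next
      case False
      have "phi (n + Suc d) ?z = phi (Suc n) ?z"
      proof (rule stop)
        fix IJ'' w assume v'': "valid (Suc n) IJ''" and w: "cmod w < 1"
        let ?s = "\<sigma> (Suc n) (snd IJ'' (Suc n))"
        show "?z \<noteq> sim_comp (Suc n) IJ'' w"
        proof
          assume "?z = sim_comp (Suc n) IJ'' w"
          then have "agree n IJ IJ'' \<and> x = chart n IJ'' (of_real (?s powr K) * w)"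
            unfolding sim_comp_Suc_chart by (intro located v'' core_in_disk(1) w)
          moreover from this have "agree n IJ' IJ''"
            using ag by (simp add: agree_def)
          ultimately have "agree (Suc n) IJ' IJ''" "y = of_real (?s powr K) * w"
            using chart_unique [OF v' v'' y(2) core_in_disk(1) [OF v'' w]] y(1) by auto
          then have "y = of_real (s powr K) * w" by (simp add: agree_Suc IJ' s_def)
          with False w s show False by (simp add: norm_mult)
        qed
      qed
      also have "\<dots> = psi_comp n IJ' (level_map (Suc n) id x)"
        using phi_Suc_on_prot_disk [OF Q v' y(2)] unfolding comp y(1) .
      also have "\<dots> = psi_comp n IJ (tail_map (Suc d) n x)"
        using False L by (simp add: y(1) IJ' comp)
      finally show ?thesis .
    qed
  qed
qed

lemma phi_eq_tail_map: "phi N z = tail_map N 0 z"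
proof (cases "cmod z < 1")
  case True
  then show ?thesis using phi_add [of 0 undefined z N] by (simp add: valid_def)
next
  case False
  then have "phi (0 + N) z = phi 0 z" by (intro phi_stable) auto
  moreover have "tail_map N 0 z = z"
  proof (cases N)
    case (Suc d)
    have "z \<notin> disk (Suc 0) p" if "p \<in> index (Suc 0)" for p
      using disk_subset_unit [of "Suc 0" "fst p" "snd p"] that False by auto
    then show ?thesis using Suc by (simp add: level_map_outside)
  qed simp
  ultimately show ?thesis by simp
qed

section \<open>The limit map\<close>

lemma phi_lim_holder:
  assumes "cmod (z - w) < 1"
  shows "cmod (phi_lim z - phi_lim w) \<le> 14 * cmod (z - w) powr \<beta>"
proof -
  have lim: "(\<lambda>N. tail_map N 0 z) \<longlonglongrightarrow> phi_lim z" for z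
    using convergent_tail_map [of 0 z] unfolding phi_lim_def phi_eq_tail_map by (rule convergent_LIMSEQ_iff [THEN iffD1])
  show ?thesis
    by (rule LIMSEQ_le_const2 [OF tendsto_norm [OF tendsto_diff [OF lim lim]]])
      (use tail_map_holder [OF assms] in blast)
qed

end

theorem theorem3p1:
  fixes K t t' :: real
    and l :: "nat \<Rightarrow> nat"
    and m :: "nat \<Rightarrow> nat \<Rightarrow> nat"
    and c :: "nat \<Rightarrow> nat \<Rightarrow> nat \<Rightarrow> complex"
    and R \<sigma> :: "nat \<Rightarrow> nat \<Rightarrow> real"
    and \<epsilon> \<delta> :: "nat \<Rightarrow> real"
    and \<phi> :: "complex \<Rightarrow> complex"
  assumes "qc_construction K t l m c R \<sigma> \<epsilon> \<delta>"
    and "t' = 2 * K * t / (2 + (K - 1) * t)"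
    and "\<phi> = qc_construction.phi_lim K l m c R \<sigma>"
  shows "\<exists>C. \<forall>z w. cmod (z - w) < 1 \<longrightarrow> cmod (\<phi> z - \<phi> w) \<le> C * cmod (z - w) powr (t / t')"
proof -
  interpret qc_construction K t l m c R \<sigma> \<epsilon> \<delta> by (fact assms(1))
  have "t / t' = holder_exponent"
    using t_pos unfolding assms(2) holder_exponent_def by simp
  then show ?thesis
    using phi_lim_holder unfolding assms(3) by auto
qed

end
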